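(* Let $K, C \subset \mathbb{R}^d$ be convex bodies. Then $$\frac{R(K,C)}{R_1(K,C)} \le \frac{(s(C)+1)\,s(K)}{s(K)+1},$$ and for every $\sigma_K,\sigma_C \in [1,d]$ there exist convex bodies $K, C\subset\mathbb{R}^d$ with $s(K)=\sigma_K$ and $s(C)=\sigma_C$ for which this inequality is tight (holds with equality).
   Context: A convex body in $\mathbb{R}^d$ is a non-empty compact convex set (not necessarily full-dimensional, not necessarily symmetric). For non-empty closed convex $K,C\subset\mathbb{R}^d$: - $C$-radius: $R(K,C) := \inf\{\rho\ge 0 : \exists c\in\mathbb{R}^d \text{ such that } K\subset c+\rho C\}\in[0,\infty]$ (with $\inf\emptyset=\infty$). - $R_1(K,C) := \sup\{R([x,y],C) : x,y\in K\}$, where $[x,y]=\mathrm{conv}\{x,y\}$ (half the $C$-diameter of $K$). - Minkowski asymmetry: $s(K) := R(-K,K)$, where $-K=\{-x:x\in K\}$. Convention: ratios of the form $0/0$ or $\infty/\infty$ are taken to be $1$.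
   Formalization: In the inequality, the Minkowski asymmetry of a one-point body is taken to be 1: by the literal definition it is 0, and the inequality then fails whenever K or C is a single point (e.g. it reads 1 ≤ 0 when K is a point). The tightness part uses the literal definition. *)

theory Defs
  imports "HOL-Analysis.Analysis"
begin

definition convex_body :: "'a::euclidean_space set \<Rightarrow> bool" where
  "convex_body K \<longleftrightarrow> K \<noteq> {} \<and> compact K \<and> convex K"

text \<open>The radius \<open>R(K,C)\<close> takes values in \<open>[0,\<infinity>]\<close>; in \<^typ>\<open>ennreal\<close> the infimum of
  the empty set is \<open>\<infinity>\<close>.\<close>

definition C_radius :: "'a::euclidean_space set \<Rightarrow> 'a set \<Rightarrow> ennreal" where
  "C_radius K C = Inf {ennreal \<rho> | \<rho>. \<rho> \<ge> 0 \<and> (\<exists>c. K \<subseteq> (\<lambda>x. c + \<rho> *\<^sub>R x) ` C)}"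

definition C_radius1 :: "'a::euclidean_space set \<Rightarrow> 'a set \<Rightarrow> ennreal" where
  "C_radius1 K C = Sup {C_radius (closed_segment x y) C | x y. x \<in> K \<and> y \<in> K}"

definition minkowski_asymmetry :: "'a::euclidean_space set \<Rightarrow> ennreal" where
  "minkowski_asymmetry K = C_radius (uminus ` K) K"

text \<open>\<^const>\<open>minkowski_asymmetry\<close> lies in \<open>[1,d]\<close> for every convex body in \<open>\<real>\<^sup>d\<close> with more than
  one point, but is \<open>0\<close> on a single point, since \<open>\<rho> = 0\<close> is admissible there. With that value
  the upper bound on \<open>R(K,C) / R\<^sub>1(K,C)\<close> would fail: if \<open>K\<close> is a point it would read \<open>1 \<le> 0\<close>, and
  if only \<open>C\<close> is a point it would read \<open>1 \<le> s(K) / (s(K) + 1)\<close>. A point, being symmetric, is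
  therefore given the value \<open>1\<close>, in keeping with \<open>1 \<le> s(K)\<close>; nothing changes for any other body.\<close>

definition minkowski_asymmetry1 :: "'a::euclidean_space set \<Rightarrow> ennreal" where
  "minkowski_asymmetry1 K = (if is_singleton K then 1 else minkowski_asymmetry K)"

text \<open>In \<^typ>\<open>ennreal\<close> itself both \<open>0 / 0\<close> and \<open>\<infinity> / \<infinity>\<close> are \<open>0\<close>.\<close>

definition ratio :: "ennreal \<Rightarrow> ennreal \<Rightarrow> ennreal" where
  "ratio a b = (if a = 0 \<and> b = 0 \<or> a = \<infinity> \<and> b = \<infinity> then 1 else a / b)"

end

theory Submission
  imports Defs
begin

text \<open>Write \<open>s = s(K)\<close>, \<open>t = s(C)\<close>, \<open>\<rho> = R\<^sub>1(K,C)\<close>, and read all inclusions up to translation.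

  The upper bound is a chain of three inclusions. From \<open>-K \<subseteq> s K\<close> follows
  \<open>(1 + 1/s) K \<subseteq> K - K\<close>; covering every segment \<open>[x,y]\<close> of \<open>K\<close> by a translate of \<open>\<rho> C\<close> gives
  \<open>K - K \<subseteq> \<rho> (C - C)\<close>; and \<open>-C \<subseteq> t C\<close> gives \<open>C - C \<subseteq> (t + 1) C\<close>. Hence \<open>K\<close> lies in a translate
  of \<open>((t + 1) s / (s + 1)) \<rho> C\<close>. This uses that the infima defining the radii are attained
  (\<open>C_radius_attained\<close>), and that the asymmetries are real numbers of size at least 1
  (\<open>minkowski_asymmetry1_attained\<close>). They are finite because a small reflected copy of a body fits
  around any of its relative interior points, and at least 1 because reflection preserves the
  diameter.

  For equality every inclusion of the chain must be tight in sufficiently many common directions.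
  Such directions are the outer normals \<open>a\<^sub>k\<close> of a simplex \<open>T = {x. a\<^sub>k \<bullet> x \<le> 1 for all k}\<close> with
  \<open>\<Sum> a\<^sub>k = 0\<close>. Along every \<open>a\<^sub>k\<close>, \<open>C\<close> should reach from \<open>-t\<close> to \<open>1\<close> and \<open>K\<close> from \<open>-1\<close> to \<open>s\<close>. The
  largest candidate for \<open>C\<close> is \<open>T \<inter> (-t T)\<close>. For \<open>K\<close> the hull of \<open>s S\<close> and \<open>-S\<close> works, where the
  vertices \<open>u\<^sub>k\<close> of the simplex \<open>S = -T/d\<close> in dimension \<open>d\<close> satisfy \<open>a\<^sub>k \<bullet> u\<^sub>k = 1\<close>. Because \<open>\<Sum> a\<^sub>k = 0\<close>, summing
  the inequalities in the directions \<open>a\<^sub>k\<close> eliminates the translation vector, which gives all the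
  lower bounds on radii that are needed (\<open>C_radius_ge_by_normals\<close>): both asymmetries are
  as prescribed, and \<open>R(K,C) \<ge> s\<close>. It remains to see \<open>R\<^sub>1(K,C) \<le> (s + 1)/(t + 1)\<close>
  (\<open>C_radius1_two_simplex_hull_le\<close>), that is,
  \<open>K - K \<subseteq> ((s + 1)/(t + 1)) (C - C)\<close>, which is checked on differences of the points spanning \<open>K\<close>. The
  quotient is then at least \<open>s (t + 1)/(s + 1)\<close>, and the upper bound supplies the converse.\<close>

section \<open>Containment in scaled translates\<close>

lemma C_radius_le:
  fixes K C :: "'a::euclidean_space set"
  assumes "\<rho> \<ge> 0" "K \<subseteq> (\<lambda>x. c + \<rho> *\<^sub>R x) ` C"
  shows "C_radius K C \<le> ennreal \<rho>"
  unfolding C_radius_def using assms by (intro Inf_lower) blast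

lemma le_C_radius:
  fixes K C :: "'a::euclidean_space set"
  assumes "\<And>\<rho> c. \<rho> \<ge> 0 \<Longrightarrow> K \<subseteq> (\<lambda>x. c + \<rho> *\<^sub>R x) ` C \<Longrightarrow> a \<le> ennreal \<rho>"
  shows "a \<le> C_radius K C"
  unfolding C_radius_def using assms by (intro Inf_greatest) blast

text \<open>If \<open>x\<^sub>0 \<in> C\<close>, the contraction of \<open>\<rho>' C\<close> about \<open>\<rho>' x\<^sub>0\<close> by the factor \<open>\<rho>/\<rho>'\<close> stays inside
  \<open>\<rho>' C\<close>, and it is a translate of \<open>\<rho> C\<close>.\<close>
lemma scaled_convex_mono:
  fixes C :: "'a::euclidean_space set"
  assumes "convex C" "C \<noteq> {}" "0 \<le> \<rho>" "\<rho> \<le> \<rho>'" "K \<subseteq> (\<lambda>x. c + \<rho> *\<^sub>R x) ` C"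
  shows "\<exists>c'. K \<subseteq> (\<lambda>x. c' + \<rho>' *\<^sub>R x) ` C"
proof (cases "\<rho>' = 0")
  case True
  then show ?thesis using assms by (metis antisym)
next
  case False
  then have pos: "\<rho>' > 0" using assms by linarith
  obtain x0 where x0: "x0 \<in> C" using assms by blast
  have "K \<subseteq> (\<lambda>x. (c - (\<rho>' - \<rho>) *\<^sub>R x0) + \<rho>' *\<^sub>R x) ` C"
  proof
    fix k assume "k \<in> K"
    then obtain x where x: "x \<in> C" "k = c + \<rho> *\<^sub>R x" using assms by blast
    let ?y = "(\<rho> / \<rho>') *\<^sub>R x + (1 - \<rho> / \<rho>') *\<^sub>R x0"
    have "?y \<in> C"
      using assms x x0 pos by (intro convexD) auto
    moreover have "\<rho>' *\<^sub>R ?y = \<rho> *\<^sub>R x + (\<rho>' - \<rho>) *\<^sub>R x0"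
      using pos by (simp add: algebra_simps)
    ultimately show "k \<in> (\<lambda>x. (c - (\<rho>' - \<rho>) *\<^sub>R x0) + \<rho>' *\<^sub>R x) ` C"
      using x by (intro image_eqI[of _ _ ?y]) auto
  qed
  then show ?thesis by blast
qed

text \<open>The admissible centres for the scalings \<open>\<rho> + 1/(n + 1)\<close> form a bounded sequence; a limit
  point of it is a centre for \<open>\<rho>\<close>, since \<open>C\<close> is compact.\<close>
lemma C_radius_attained:
  fixes K C :: "'a::euclidean_space set"
  assumes K: "K \<noteq> {}" and C: "convex_body C" and "\<rho> \<ge> 0" and le: "C_radius K C \<le> ennreal \<rho>"
  shows "\<exists>c. K \<subseteq> (\<lambda>x. c + \<rho> *\<^sub>R x) ` C"
proof -
  have C': "C \<noteq> {}" "compact C" "convex C" using C by (auto simp: convex_body_def)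
  define r where "r n = \<rho> + 1 / real (Suc n)" for n
  have r0: "0 \<le> r n" for n using \<open>\<rho> \<ge> 0\<close> by (simp add: r_def)
  have r1: "r n \<le> \<rho> + 1" for n by (simp add: r_def)
  have rlim: "r \<longlonglongrightarrow> \<rho>"
    unfolding r_def using tendsto_add[OF tendsto_const LIMSEQ_inverse_real_of_nat]
    by (simp add: inverse_eq_divide)
  have "\<exists>c. K \<subseteq> (\<lambda>x. c + r n *\<^sub>R x) ` C" for n
  proof -
    have "C_radius K C < ennreal (r n)"
      using le \<open>\<rho> \<ge> 0\<close> by (auto simp: r_def intro!: le_less_trans[OF le] ennreal_lessI)
    then obtain q c where "q \<ge> 0" "ennreal q < ennreal (r n)" "K \<subseteq> (\<lambda>x. c + q *\<^sub>R x) ` C"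
      unfolding C_radius_def Inf_less_iff by blast
    then show ?thesis
      using scaled_convex_mono[OF C'(3,1), of q "r n"] by (simp add: ennreal_less_iff)
  qed
  then obtain c where c: "\<And>n. K \<subseteq> (\<lambda>x. c n + r n *\<^sub>R x) ` C" by metis
  obtain B where B: "\<And>x. x \<in> C \<Longrightarrow> norm x \<le> B"
    using C' compact_imp_bounded bounded_iff by metis
  obtain k0 where k0: "k0 \<in> K" using K by blast
  have "norm (c n) \<le> norm k0 + (\<rho> + 1) * B" for n
  proof -
    obtain x where x: "x \<in> C" "k0 = c n + r n *\<^sub>R x" using c k0 by blast
    have "norm (c n) = norm (k0 - r n *\<^sub>R x)" using x by simp
    also have "\<dots> \<le> norm k0 + r n * norm x"
      using norm_triangle_ineq4[of k0 "r n *\<^sub>R x"] r0[of n] by simp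
    also have "r n * norm x \<le> (\<rho> + 1) * B"
      using B[OF x(1)] r1[of n] r0[of n] \<open>\<rho> \<ge> 0\<close> by (intro mult_mono) auto
    finally show ?thesis by simp
  qed
  then have "bounded (range c)" by (auto simp: bounded_iff)
  then obtain l f where f: "strict_mono f" "(c \<circ> f) \<longlonglongrightarrow> l"
    using bounded_imp_convergent_subsequence by blast
  have "K \<subseteq> (\<lambda>x. l + \<rho> *\<^sub>R x) ` C"
  proof
    fix k assume "k \<in> K"
    then have "\<forall>n. \<exists>x. x \<in> C \<and> k = c n + r n *\<^sub>R x" using c by blast
    then obtain x where x: "\<And>n. x n \<in> C" "\<And>n. k = c n + r n *\<^sub>R x n" by metis
    obtain y g where y: "y \<in> C" and g: "strict_mono g" "((x \<circ> f) \<circ> g) \<longlonglongrightarrow> y"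
      using C'(2) x(1) unfolding compact_def by (metis comp_apply)
    have "((c \<circ> f) \<circ> g) \<longlonglongrightarrow> l" by (rule LIMSEQ_subseq_LIMSEQ[OF f(2) g(1)])
    moreover have "((r \<circ> f) \<circ> g) \<longlonglongrightarrow> \<rho>"
      by (intro LIMSEQ_subseq_LIMSEQ rlim f g)
    ultimately have "(\<lambda>n. c (f (g n)) + r (f (g n)) *\<^sub>R x (f (g n))) \<longlonglongrightarrow> l + \<rho> *\<^sub>R y"
      using g(2) by (intro tendsto_intros) (simp_all add: o_def)
    then have "(\<lambda>n. k) \<longlonglongrightarrow> l + \<rho> *\<^sub>R y" using x(2) by simp
    then have "k = l + \<rho> *\<^sub>R y" by (simp add: LIMSEQ_const_iff)
    then show "k \<in> (\<lambda>x. l + \<rho> *\<^sub>R x) ` C" using y by blast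
  qed
  then show ?thesis by blast
qed

text \<open>From \<open>K \<subseteq> c + \<rho> C\<close> one reads off \<open>h \<le> a\<^sub>k \<bullet> c + \<rho>\<close> for every \<open>k\<close>. Averaging over \<open>k\<close> removes
  the unknown centre \<open>c\<close>, because the normals sum to zero.\<close>
lemma C_radius_ge_by_normals:
  fixes K C :: "'a::euclidean_space set" and a :: "'k \<Rightarrow> 'a"
  assumes "finite I" "I \<noteq> {}" and sum0: "(\<Sum>k\<in>I. a k) = 0"
    and C: "\<And>k x. k \<in> I \<Longrightarrow> x \<in> C \<Longrightarrow> a k \<bullet> x \<le> 1"
    and K: "\<And>k. k \<in> I \<Longrightarrow> \<exists>y\<in>K. a k \<bullet> y \<ge> h"
  shows "ennreal h \<le> C_radius K C"
proof (rule le_C_radius)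
  fix \<rho> c assume \<rho>: "0 \<le> \<rho>" and sub: "K \<subseteq> (\<lambda>x. c + \<rho> *\<^sub>R x) ` C"
  have le: "h \<le> a k \<bullet> c + \<rho>" if k: "k \<in> I" for k
  proof -
    obtain y where y: "y \<in> K" "h \<le> a k \<bullet> y" using K[OF k] by blast
    then obtain x where x: "x \<in> C" "y = c + \<rho> *\<^sub>R x" using sub by blast
    have "\<rho> * (a k \<bullet> x) \<le> \<rho>" using C[OF k x(1)] \<rho> by (simp add: mult_left_le)
    then show ?thesis using y x by (simp add: inner_add_right)
  qed
  have "real (card I) * h = (\<Sum>k\<in>I. h)" by simp
  also have "\<dots> \<le> (\<Sum>k\<in>I. a k \<bullet> c + \<rho>)" by (intro sum_mono le)
  also have "\<dots> = real (card I) * \<rho>"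
    by (simp add: sum.distrib flip: inner_sum_left) (simp add: sum0)
  finally have "h \<le> \<rho>" using assms(1,2) by (simp add: card_gt_0_iff)
  then show "ennreal h \<le> ennreal \<rho>" by (rule ennreal_leI)
qed

lemma C_radius_segment_le:
  fixes C :: "'a::euclidean_space set"
  assumes "convex C" "p \<in> C" "q \<in> C" "\<rho> \<ge> 0" "x - y = \<rho> *\<^sub>R (p - q)"
  shows "C_radius (closed_segment x y) C \<le> ennreal \<rho>"
proof (rule C_radius_le[OF \<open>\<rho> \<ge> 0\<close>, where c = "x - \<rho> *\<^sub>R p"])
  let ?D = "(\<lambda>z. (x - \<rho> *\<^sub>R p) + \<rho> *\<^sub>R z) ` C"
  have "y = (x - \<rho> *\<^sub>R p) + \<rho> *\<^sub>R q" using assms(5) by (simp add: algebra_simps)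
  then have "x \<in> ?D" "y \<in> ?D" using assms(2,3) by auto
  moreover have "convex ?D" using assms(1) by (rule convex_affinity)
  ultimately show "closed_segment x y \<subseteq> ?D" by (simp add: closed_segment_subset)
qed

section \<open>The Minkowski asymmetry\<close>

text \<open>Finiteness of the asymmetry. A body need not have interior points, so the reflection is taken
  in a relative interior point \<open>p\<close>: reflecting about \<open>p\<close> and shrinking by a large factor \<open>\<rho>\<close> keeps
  every point of \<open>K\<close> in the affine hull and moves it into the ball about \<open>p\<close> that \<open>K\<close> contains
  within that hull.\<close>
lemma reflection_in_scaled_translate:
  fixes K :: "'a::euclidean_space set"
  assumes "convex_body K"
  shows "\<exists>\<rho>\<ge>0. \<exists>c. uminus ` K \<subseteq> (\<lambda>x. c + \<rho> *\<^sub>R x) ` K"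
proof -
  have K: "K \<noteq> {}" "bounded K" "convex K"
    using assms compact_imp_bounded by (auto simp: convex_body_def)
  then obtain p where "p \<in> rel_interior K" using rel_interior_eq_empty by blast
  then obtain e where e: "e > 0" "ball p e \<inter> affine hull K \<subseteq> K" and p: "p \<in> K"
    unfolding mem_rel_interior_ball by blast
  obtain B where B: "B > 0" "\<And>x. x \<in> K \<Longrightarrow> norm x \<le> B"
    using K(2) bounded_pos by metis
  \<comment> \<open>\<open>K\<close> has diameter at most \<open>2 B\<close>, so dividing by \<open>\<rho>\<close> brings its points within \<open>e/2\<close> of \<open>p\<close>.\<close>
  define \<rho> where "\<rho> = 4 * B / e"
  have \<rho>: "\<rho> > 0" using B e by (simp add: \<rho>_def)
  have "uminus ` K \<subseteq> (\<lambda>x. (- p - \<rho> *\<^sub>R p) + \<rho> *\<^sub>R x) ` K"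
  proof (rule image_subsetI)
    fix y assume y: "y \<in> K"
    let ?z = "p - (1 / \<rho>) *\<^sub>R (y - p)"
    have "?z = (1 + 1 / \<rho>) *\<^sub>R p + (- (1 / \<rho>)) *\<^sub>R y" by (simp add: algebra_simps)
    moreover have "\<dots> \<in> affine hull K"
      using p y by (intro mem_affine affine_affine_hull hull_inc) auto
    ultimately have aff: "?z \<in> affine hull K" by metis
    have "norm (y - p) \<le> 2 * B"
      using norm_triangle_ineq4[of y p] B(2)[OF y] B(2)[OF p] by linarith
    then have "1 / \<rho> * norm (y - p) \<le> 1 / \<rho> * (2 * B)" using \<rho> by (intro mult_left_mono) auto
    moreover have "1 / \<rho> * (2 * B) < e" using e B by (simp add: \<rho>_def)
    moreover have "dist p ?z = 1 / \<rho> * norm (y - p)" using \<rho> by (simp add: dist_norm)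
    ultimately have "dist p ?z < e" by linarith
    with aff have "?z \<in> K" using e by auto
    moreover have "- y = (- p - \<rho> *\<^sub>R p) + \<rho> *\<^sub>R ?z"
      using \<rho> by (simp add: algebra_simps)
    ultimately show "- y \<in> (\<lambda>x. (- p - \<rho> *\<^sub>R p) + \<rho> *\<^sub>R x) ` K" by blast
  qed
  then show ?thesis using \<rho> by (metis less_imp_le)
qed

text \<open>Reflection preserves the diameter while scaling multiplies it by \<open>\<rho>\<close>.\<close>
lemma reflection_scale_ge_1:
  fixes K :: "'a::euclidean_space set"
  assumes "convex_body K" "\<not> is_singleton K" "\<rho> \<ge> 0" "uminus ` K \<subseteq> (\<lambda>x. c + \<rho> *\<^sub>R x) ` K"
  shows "\<rho> \<ge> 1"
proof -
  have K: "K \<noteq> {}" "compact K" using assms by (auto simp: convex_body_def)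
  obtain x y where xy: "x \<in> K" "y \<in> K" "dist x y = diameter K"
    using diameter_compact_attained[OF K(2,1)] by blast
  obtain u v where uv: "u \<in> K" "v \<in> K" "u \<noteq> v"
    using assms(2) K(1) by (metis is_singletonI')
  have dia: "dist u v \<le> diameter K" if "u \<in> K" "v \<in> K" for u v
    using that diameter_bounded_bound[OF compact_imp_bounded[OF K(2)]] by blast
  have pos: "diameter K > 0" using dia[OF uv(1,2)] uv(3) by (smt (verit) zero_less_dist_iff)
  obtain x' y' where x': "x' \<in> K" "- x = c + \<rho> *\<^sub>R x'" and y': "y' \<in> K" "- y = c + \<rho> *\<^sub>R y'"
    using assms(4) xy by blast
  have "diameter K = dist (- x) (- y)" using xy by (simp add: dist_norm norm_minus_commute)
  also have "\<dots> = \<rho> * dist x' y'"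
    unfolding x'(2) y'(2) using \<open>\<rho> \<ge> 0\<close> by (simp add: dist_norm flip: scaleR_diff_right)
  also have "\<dots> \<le> \<rho> * diameter K" using dia x' y' \<open>\<rho> \<ge> 0\<close> by (intro mult_left_mono) auto
  finally show ?thesis using pos by simp
qed

text \<open>A point satisfies the inclusion with its conventional value 1 as well, so the upper bound can
  treat singletons and all other bodies alike.\<close>
lemma minkowski_asymmetry1_attained:
  fixes K :: "'a::euclidean_space set"
  assumes "convex_body K"
  obtains s c where "s \<ge> 1" "minkowski_asymmetry1 K = ennreal s"
    "uminus ` K \<subseteq> (\<lambda>x. c + s *\<^sub>R x) ` K"
proof (cases "is_singleton K")
  case True
  then obtain x where x: "K = {x}" by (auto simp: is_singleton_def)
  show ?thesis
    using that[of 1 "- 2 *\<^sub>R x"] True x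
    by (auto simp: minkowski_asymmetry1_def scaleR_2)
next
  case False
  obtain \<rho> c where "\<rho> \<ge> 0" "uminus ` K \<subseteq> (\<lambda>x. c + \<rho> *\<^sub>R x) ` K"
    using reflection_in_scaled_translate[OF assms] by blast
  then have "C_radius (uminus ` K) K \<le> ennreal \<rho>" by (rule C_radius_le)
  then obtain s where s: "C_radius (uminus ` K) K = ennreal s" "s \<ge> 0"
    by (cases "C_radius (uminus ` K) K") (auto simp: top_unique)
  then obtain c' where "uminus ` K \<subseteq> (\<lambda>x. c' + s *\<^sub>R x) ` K"
    using C_radius_attained[of "uminus ` K" K s] assms by (auto simp: convex_body_def)
  then show ?thesis
    using that[of s c'] reflection_scale_ge_1[OF assms False s(2)] s False
    by (simp add: minkowski_asymmetry1_def minkowski_asymmetry_def)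
qed

section \<open>The upper bound\<close>

text \<open>The chain \<open>(1 + 1/s) K \<subseteq> K - K \<subseteq> \<rho> (C - C) \<subseteq> (t + 1) \<rho> C\<close>, up to translation, is followed
  for each point \<open>x \<in> K\<close> separately: \<open>y \<in> K\<close> is the point that \<open>-K \<subseteq> c + s K\<close> assigns to \<open>-x\<close>,
  so that \<open>x + x/s\<close> differs from \<open>x - y\<close> only by a constant vector.\<close>
lemma C_radius_bound:
  fixes K C :: "'a::euclidean_space set"
  assumes "convex_body C" and "s > 0" "t \<ge> 0" "\<rho> \<ge> 0"
    and R1: "C_radius1 K C \<le> ennreal \<rho>"
    and s: "uminus ` K \<subseteq> (\<lambda>x. c + s *\<^sub>R x) ` K"
    and t: "uminus ` C \<subseteq> (\<lambda>x. b + t *\<^sub>R x) ` C"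
  shows "C_radius K C \<le> ennreal ((t + 1) * s / (s + 1) * \<rho>)"
proof (rule C_radius_le)
  let ?l = "s / (s + 1)"
  show "0 \<le> (t + 1) * s / (s + 1) * \<rho>" using assms by simp
  show "K \<subseteq> (\<lambda>x. (?l * \<rho>) *\<^sub>R b - (1 / (s + 1)) *\<^sub>R c + ((t + 1) * s / (s + 1) * \<rho>) *\<^sub>R x) ` C"
  proof
    fix x assume x: "x \<in> K"
    then obtain y where y: "y \<in> K" "- x = c + s *\<^sub>R y" using s by blast
    have "C_radius (closed_segment x y) C \<le> C_radius1 K C"
      unfolding C_radius1_def using x y by (intro Sup_upper) blast
    then obtain m where m: "closed_segment x y \<subseteq> (\<lambda>x. m + \<rho> *\<^sub>R x) ` C"
      using C_radius_attained[OF _ assms(1) \<open>\<rho> \<ge> 0\<close>, of "closed_segment x y"] R1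
      by (metis ends_in_segment(1) empty_iff order_trans)
    obtain p q where p: "p \<in> C" "x = m + \<rho> *\<^sub>R p" and q: "q \<in> C" "y = m + \<rho> *\<^sub>R q"
      using subsetD[OF m, of x] subsetD[OF m, of y] by auto
    obtain q' where q': "q' \<in> C" "- q = b + t *\<^sub>R q'" using t q(1) by blast
    \<comment> \<open>\<open>p - q\<close> is \<open>p + t q'\<close> up to a constant, and this is \<open>t + 1\<close> times a point of \<open>C\<close>.\<close>
    let ?z = "(1 / (t + 1)) *\<^sub>R p + (t / (t + 1)) *\<^sub>R q'"
    have "?z \<in> C"
      using assms(1) p q' \<open>t \<ge> 0\<close>
      by (intro convexD) (auto simp: convex_body_def field_simps)
    moreover have "x = (?l * \<rho>) *\<^sub>R b - (1 / (s + 1)) *\<^sub>R c + ((t + 1) * s / (s + 1) * \<rho>) *\<^sub>R ?z"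
    proof -
      have z: "(t + 1) *\<^sub>R ?z = p + t *\<^sub>R q'"
        using \<open>t \<ge> 0\<close> by (simp add: scaleR_add_right)
      have "x - y = \<rho> *\<^sub>R (p - q)" using p q by (simp add: scaleR_diff_right)
      also have "p - q = p + (b + t *\<^sub>R q')" unfolding q'(2)[symmetric] by simp
      also have "\<dots> = (t + 1) *\<^sub>R ?z + b" unfolding z by (simp add: algebra_simps)
      finally have xy: "x - y = \<rho> *\<^sub>R ((t + 1) *\<^sub>R ?z + b)" .
      have "- x - c = s *\<^sub>R y" unfolding y(2) by simp
      then have "s *\<^sub>R (x - y) = s *\<^sub>R x - (- x - c)" by (simp add: scaleR_diff_right)
      also have "\<dots> = s *\<^sub>R x + (x + c)" by simp
      also have "\<dots> = (s + 1) *\<^sub>R x + c" by (simp add: algebra_simps)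
      finally have "(s + 1) *\<^sub>R x = s *\<^sub>R (x - y) - c" by simp
      then have "x = (1 / (s + 1)) *\<^sub>R (s *\<^sub>R (x - y) - c)"
        using \<open>s > 0\<close> by (metis (no_types, opaque_lifting) add_pos_pos divide_inverse mult.left_neutral
            less_irrefl scaleR_left_imp_eq scaleR_scaleR right_inverse scaleR_one zero_less_one)
      also have "\<dots> = ?l *\<^sub>R (x - y) - (1 / (s + 1)) *\<^sub>R c"
        by (simp add: scaleR_diff_right)
      finally show ?thesis unfolding xy
        by (simp add: scaleR_add_right mult_ac)
    qed
    ultimately show "x \<in> (\<lambda>x. (?l * \<rho>) *\<^sub>R b - (1 / (s + 1)) *\<^sub>R c
        + ((t + 1) * s / (s + 1) * \<rho>) *\<^sub>R x) ` C" by blast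
  qed
qed

lemma asymmetry_bound_ennreal:
  assumes "s \<ge> 0" "t \<ge> 0"
  shows "(ennreal t + 1) * ennreal s / (ennreal s + 1) = ennreal ((t + 1) * s / (s + 1))"
proof -
  have "(ennreal t + 1) * ennreal s = ennreal ((t + 1) * s)"
    using assms by (simp add: ennreal_mult ennreal_plus flip: ennreal_1)
  moreover have "ennreal s + 1 = ennreal (s + 1)" using assms by (simp flip: ennreal_1)
  ultimately show ?thesis using assms by (simp add: divide_ennreal del: ennreal_plus)
qed

lemma radius_ratio_le:
  fixes K C :: "'a::euclidean_space set"
  assumes "convex_body K" "convex_body C"
  shows "ratio (C_radius K C) (C_radius1 K C)
    \<le> (minkowski_asymmetry1 C + 1) * minkowski_asymmetry1 K / (minkowski_asymmetry1 K + 1)"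
proof -
  obtain s c where s: "s \<ge> 1" "minkowski_asymmetry1 K = ennreal s"
    "uminus ` K \<subseteq> (\<lambda>x. c + s *\<^sub>R x) ` K" by (rule minkowski_asymmetry1_attained[OF assms(1)])
  obtain t b where t: "t \<ge> 1" "minkowski_asymmetry1 C = ennreal t"
    "uminus ` C \<subseteq> (\<lambda>x. b + t *\<^sub>R x) ` C" by (rule minkowski_asymmetry1_attained[OF assms(2)])
  define \<mu> where "\<mu> = (t + 1) * s / (s + 1)"
  \<comment> \<open>The bound is at least 1, so it covers the quotients that equal 1 by convention.\<close>
  have "s + 1 \<le> 2 * s" using s by simp
  also have "\<dots> \<le> (t + 1) * s" using s t by (intro mult_right_mono) auto
  finally have \<mu>: "1 \<le> \<mu>" using s by (simp add: \<mu>_def)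
  have "ratio (C_radius K C) (C_radius1 K C) \<le> ennreal \<mu>"
  proof (cases "C_radius1 K C")
    case top
    then show ?thesis using \<mu> by (auto simp: ratio_def ennreal_divide_top)
  next
    case (real \<rho>)
    have R: "C_radius K C \<le> ennreal (\<mu> * \<rho>)"
      using C_radius_bound[OF assms(2) _ _ real(1) _ s(3) t(3)] s t real by (simp add: \<mu>_def)
    show ?thesis
    proof (cases "\<rho> = 0")
      case True
      then show ?thesis using R real \<mu> by (simp add: ratio_def)
    next
      case False
      then have "C_radius K C / C_radius1 K C \<le> ennreal (\<mu> * \<rho>) / ennreal \<rho>"
        using R real by (simp add: divide_right_mono_ennreal)
      also have "\<dots> = ennreal \<mu>" using False real \<mu> by (simp add: divide_ennreal)
      finally show ?thesis using False real by (auto simp: ratio_def)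
    qed
  qed
  then show ?thesis
    using asymmetry_bound_ennreal[of s t] s t by (simp add: \<mu>_def)
qed

section \<open>A simplex and its facet normals\<close>

text \<open>Index set \<open>'n option\<close> has the \<open>d + 1\<close> elements needed for the facets of a simplex in
  \<open>\<real>\<^sup>d\<close>. Every condition used below is affinely invariant, so a regular simplex is not required;
  taking the coordinate vectors together with minus their sum makes the functionals
  \<open>x \<mapsto> facet_normal k \<bullet> x\<close> explicit.\<close>
definition facet_normal :: "'n option \<Rightarrow> real ^ 'n::finite" where
  "facet_normal k = (case k of None \<Rightarrow> - (\<Sum>i\<in>UNIV. axis i 1) | Some i \<Rightarrow> axis i 1)"

lemma facet_normal_inner:
  "facet_normal (Some i) \<bullet> x = x $ i"
  "facet_normal None \<bullet> x = - (\<Sum>i\<in>UNIV. x $ i)"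
  by (simp_all add: facet_normal_def inner_axis inner_axis' inner_sum_left)

lemma sum_UNIV_option:
  fixes f :: "'n::finite option \<Rightarrow> 'a::comm_monoid_add"
  shows "(\<Sum>k\<in>UNIV. f k) = f None + (\<Sum>i\<in>UNIV. f (Some i))"
  by (simp add: UNIV_option_conv sum.reindex)

lemma sum_facet_normal: "(\<Sum>k\<in>UNIV. facet_normal k) = 0"
  by (simp add: sum_UNIV_option) (simp add: facet_normal_def)

lemma eq_by_facet_normals:
  assumes "\<And>k. facet_normal k \<bullet> x = facet_normal k \<bullet> y"
  shows "x = y"
  using assms facet_normal_inner(1) by (metis vec_eq_iff)

text \<open>The values of a point on the \<open>d + 1\<close> normals act as coordinates subject to the single
  relation that they sum to zero. With \<open>eq_by_facet_normals\<close> this makes it possible to construct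
  and compare points by these coordinates alone.\<close>
lemma point_with_facet_coordinates:
  fixes f :: "'n::finite option \<Rightarrow> real"
  assumes "(\<Sum>k\<in>UNIV. f k) = 0"
  obtains x where "\<And>k. facet_normal k \<bullet> x = f k"
proof
  fix k show "facet_normal k \<bullet> (\<chi> i. f (Some i)) = f k"
    using assms by (cases k) (auto simp: facet_normal_inner sum_UNIV_option)
qed

text \<open>The point with coordinate \<open>1\<close> on the normal \<open>k\<close> and equal coordinates \<open>-1/d\<close> on the others.
  The simplex cut out by the inequalities \<open>facet_normal k \<bullet> x \<le> 1\<close> has the vertices
  \<open>- d *\<^sub>R dual_vertex k\<close>.\<close>
definition dual_vertex :: "'n option \<Rightarrow> real ^ 'n::finite" where
  "dual_vertex k = (\<chi> i. if k = Some i then 1 else - 1 / real CARD('n))"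

lemma facet_normal_dual_vertex:
  fixes k :: "'n::finite option"
  shows "facet_normal m \<bullet> dual_vertex k = (if m = k then 1 else - 1 / real CARD('n))"
proof (cases m)
  case None
  show ?thesis
  proof (cases k)
    case (Some j)
    have "(\<Sum>i\<in>UNIV. if j = i then 1 else - 1 / real CARD('n))
        = (\<Sum>i\<in>UNIV. (if j = i then 1 + 1 / real CARD('n) else 0) - 1 / real CARD('n))"
      by (intro sum.cong) auto
    also have "\<dots> = 1 / real CARD('n)" by (simp add: sum_subtractf)
    finally show ?thesis using None Some by (simp add: facet_normal_inner dual_vertex_def)
  qed (simp add: None facet_normal_inner dual_vertex_def)
qed (auto simp: facet_normal_inner dual_vertex_def)

section \<open>Bodies attaining the bound\<close>

text \<open>This is \<open>T \<inter> (-t T)\<close> for the simplex \<open>T\<close> with the given facet normals. Among the bodies with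
  support value \<open>1\<close> in every direction \<open>facet_normal k\<close> and with \<open>-C \<subseteq> t C\<close> it is the largest, hence
  the one whose difference body has the best chance to contain that of \<open>K\<close>.\<close>
definition truncated_simplex :: "real \<Rightarrow> (real ^ 'n::finite) set" where
  "truncated_simplex t = {x. \<forall>k. - t \<le> facet_normal k \<bullet> x \<and> facet_normal k \<bullet> x \<le> 1}"

lemma convex_body_truncated_simplex:
  assumes "t \<ge> 0"
  shows "convex_body (truncated_simplex t :: (real ^ 'n::finite) set)"
proof -
  let ?C = "truncated_simplex t :: (real ^ 'n) set"
  have eq: "?C = (\<Inter>k. {x. facet_normal k \<bullet> x \<ge> - t} \<inter> {x. facet_normal k \<bullet> x \<le> 1})"
    by (auto simp: truncated_simplex_def)
  have "convex ?C" unfolding eq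
    by (intro convex_INT convex_Int convex_halfspace_ge convex_halfspace_le)
  moreover have "closed ?C" unfolding eq
    by (intro closed_INT ballI closed_Int closed_halfspace_ge closed_halfspace_le)
  moreover have "?C \<subseteq> cbox (vec (- t)) (vec 1)"
  proof
    fix x assume "x \<in> ?C"
    then have "- t \<le> facet_normal (Some i) \<bullet> x \<and> facet_normal (Some i) \<bullet> x \<le> 1" for i
      by (simp add: truncated_simplex_def)
    then show "x \<in> cbox (vec (- t)) (vec 1)"
      by (simp add: mem_box_cart facet_normal_inner)
  qed
  then have "bounded ?C" using bounded_cbox bounded_subset by blast
  moreover have "0 \<in> ?C" using assms by (simp add: truncated_simplex_def)
  ultimately show ?thesis by (auto simp: convex_body_def compact_eq_bounded_closed)
qed

lemma asymmetry_truncated_simplex: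
  assumes t: "1 \<le> t" "t \<le> real CARD('n)"
  shows "minkowski_asymmetry (truncated_simplex t :: (real ^ 'n::finite) set) = ennreal t"
  unfolding minkowski_asymmetry_def
proof (rule antisym)
  let ?C = "truncated_simplex t :: (real ^ 'n) set"
  have tt: "t \<le> t * t" "1 \<le> t * t" using t mult_mono[of 1 t 1 t] by auto
  have "uminus ` ?C \<subseteq> (\<lambda>x. 0 + t *\<^sub>R x) ` ?C"
  proof (rule image_subsetI)
    fix x assume "x \<in> ?C"
    then have "(- 1 / t) *\<^sub>R x \<in> ?C"
      using t tt by (auto simp: truncated_simplex_def field_simps intro: order_trans)
    moreover have "- x = 0 + t *\<^sub>R ((- 1 / t) *\<^sub>R x)" using t by simp
    ultimately show "- x \<in> (\<lambda>x. 0 + t *\<^sub>R x) ` ?C" by blast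
  qed
  with t show "C_radius (uminus ` ?C) ?C \<le> ennreal t" by (intro C_radius_le[of t _ 0]) auto
  show "ennreal t \<le> C_radius (uminus ` ?C) ?C"
  proof (rule C_radius_ge_by_normals[where I = UNIV and a = facet_normal])
    fix k :: "'n option"
    \<comment> \<open>Here \<open>t \<le> d\<close> enters: the remaining coordinates \<open>t/d\<close> must not exceed \<open>1\<close>.\<close>
    have "(- t) *\<^sub>R dual_vertex k \<in> ?C"
      using t by (auto simp: truncated_simplex_def facet_normal_dual_vertex field_simps
          intro: order_trans[of _ 0])
    then show "\<exists>y\<in>uminus ` ?C. t \<le> facet_normal k \<bullet> y"
      by (intro bexI[of _ "- ((- t) *\<^sub>R dual_vertex k)"] imageI)
        (simp_all add: facet_normal_dual_vertex)
  qed (auto simp: sum_facet_normal truncated_simplex_def)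
qed

text \<open>The hull of \<open>s S\<close> and \<open>-S\<close>, with \<open>S\<close> the simplex spanned by the dual vertices. It
  interpolates between the symmetric hull of \<open>S\<close> and \<open>-S\<close> for \<open>s = 1\<close> and the simplex \<open>d S\<close> for
  \<open>s = d\<close>.\<close>
definition two_simplex_hull :: "real \<Rightarrow> (real ^ 'n::finite) set" where
  "two_simplex_hull s =
    convex hull (range (\<lambda>k. s *\<^sub>R dual_vertex k) \<union> range (\<lambda>k. - dual_vertex k))"

lemma vertices_in_two_simplex_hull:
  "s *\<^sub>R dual_vertex k \<in> two_simplex_hull s" "- dual_vertex k \<in> two_simplex_hull s"
  unfolding two_simplex_hull_def by (auto intro!: hull_inc)

lemma two_simplex_hull_subset:
  assumes "convex S" "\<And>k. s *\<^sub>R dual_vertex k \<in> S" "\<And>k. - dual_vertex k \<in> S"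
  shows "two_simplex_hull s \<subseteq> S"
  unfolding two_simplex_hull_def using assms by (intro hull_minimal) auto

lemma convex_body_two_simplex_hull:
  "convex_body (two_simplex_hull s :: (real ^ 'n::finite) set)"
  using vertices_in_two_simplex_hull(1)[of s "None :: 'n option"]
  by (auto simp: convex_body_def two_simplex_hull_def finite_imp_compact_convex_hull
      simp del: convex_hull_eq_empty)

text \<open>The upper estimate needs \<open>u/s\<close> to lie on the segment from \<open>-u\<close> to \<open>s u\<close> for each vertex \<open>u\<close> of
  \<open>S\<close>. For the lower estimate the negated normals are used: the hull has support value \<open>1\<close> in these
  directions (by \<open>s \<le> d\<close>), and its reflection reaches \<open>s\<close>.\<close>
lemma asymmetry_two_simplex_hull:
  assumes s: "1 \<le> s" "s \<le> real CARD('n)"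
  shows "minkowski_asymmetry (two_simplex_hull s :: (real ^ 'n::finite) set) = ennreal s"
  unfolding minkowski_asymmetry_def
proof (rule antisym)
  let ?K = "two_simplex_hull s :: (real ^ 'n) set"
  have conv: "convex ?K" by (simp add: two_simplex_hull_def)
  have "?K \<subseteq> {x. - x \<in> (\<lambda>x. 0 + s *\<^sub>R x) ` ?K}"
  proof (rule two_simplex_hull_subset)
    have "convex (uminus -` (\<lambda>x. 0 + s *\<^sub>R x) ` ?K)"
      by (intro convex_linear_vimage convex_affinity conv linear_uminus)
    then show "convex {x. - x \<in> (\<lambda>x. 0 + s *\<^sub>R x) ` ?K}" by (simp add: vimage_def)
    fix k :: "'n option"
    show "s *\<^sub>R dual_vertex k \<in> {x. - x \<in> (\<lambda>x. 0 + s *\<^sub>R x) ` ?K}"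
      using vertices_in_two_simplex_hull(2)[of k s] by (auto intro!: image_eqI)
    let ?w = "1 / s"
    \<comment> \<open>The weights write \<open>dual_vertex k / s\<close> as a convex combination of the two opposite vertices.\<close>
    have "((1 + ?w) / (s + 1)) *\<^sub>R (s *\<^sub>R dual_vertex k)
        + ((s - ?w) / (s + 1)) *\<^sub>R (- dual_vertex k) \<in> ?K"
    proof (rule convexD[OF conv vertices_in_two_simplex_hull])
      have "?w \<le> 1" using s by simp
      then show "0 \<le> (s - ?w) / (s + 1)" using s by (intro divide_nonneg_pos) linarith+
      show "0 \<le> (1 + ?w) / (s + 1)" using s by simp
      show "(1 + ?w) / (s + 1) + (s - ?w) / (s + 1) = 1"
        using s by (simp flip: add_divide_distrib)
    qed
    also have "((1 + ?w) / (s + 1)) *\<^sub>R (s *\<^sub>R dual_vertex k)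
        + ((s - ?w) / (s + 1)) *\<^sub>R (- dual_vertex k)
        = ((1 + ?w) / (s + 1) * s - (s - ?w) / (s + 1)) *\<^sub>R dual_vertex k"
      by (simp add: scaleR_diff_left)
    also have "(1 + ?w) / (s + 1) * s - (s - ?w) / (s + 1) = ?w"
    proof -
      have "s + s * s > 0" using s by (intro add_pos_pos) auto
      then show ?thesis using s by (simp add: field_simps)
    qed
    finally show "- dual_vertex k \<in> {x. - x \<in> (\<lambda>x. 0 + s *\<^sub>R x) ` ?K}"
      using s by (auto intro!: image_eqI)
  qed
  then show "C_radius (uminus ` ?K) ?K \<le> ennreal s"
    using s by (intro C_radius_le[of s _ 0]) auto
  show "ennreal s \<le> C_radius (uminus ` ?K) ?K"
  proof (rule C_radius_ge_by_normals[where I = UNIV and a = "\<lambda>k. - facet_normal k"])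
    fix k :: "'n option"
    have "?K \<subseteq> {x. facet_normal k \<bullet> x \<ge> - 1}"
      using s by (intro two_simplex_hull_subset convex_halfspace_ge)
        (auto simp: facet_normal_dual_vertex field_simps)
    then show "- facet_normal k \<bullet> x \<le> 1" if "x \<in> ?K" for x using that by auto
    show "\<exists>y\<in>uminus ` ?K. s \<le> - facet_normal k \<bullet> y"
      using vertices_in_two_simplex_hull(1)[of s k]
      by (intro bexI[of _ "- (s *\<^sub>R dual_vertex k)"] imageI)
        (auto simp: facet_normal_dual_vertex)
  qed (auto simp: sum_facet_normal sum_negf)
qed

lemma radial_difference_in_truncated_simplex:
  fixes k :: "'n::finite option"
  assumes t: "1 \<le> t" "t \<le> real CARD('n)"
  shows "\<exists>p\<in>truncated_simplex t. \<exists>q\<in>truncated_simplex t. (t + 1) *\<^sub>R dual_vertex k = p - q"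
proof (intro bexI)
  show "(t + 1) *\<^sub>R dual_vertex k = dual_vertex k - (- t) *\<^sub>R dual_vertex k"
    by (simp add: algebra_simps)
  have "1 \<le> t * real CARD('n)" using t mult_mono[of 1 t 1 "real CARD('n)"] by simp
  then show "dual_vertex k \<in> truncated_simplex t"
    using t by (auto simp: truncated_simplex_def facet_normal_dual_vertex field_simps)
  show "(- t) *\<^sub>R dual_vertex k \<in> truncated_simplex t"
    using t by (auto simp: truncated_simplex_def facet_normal_dual_vertex field_simps
        intro: order_trans[of _ 0])
qed

text \<open>The factor is such that the left-hand side has coordinates \<open>t + 1\<close>, \<open>-(t + 1)\<close> on the normals
  \<open>k\<close> and \<open>j\<close> and zero on the others. So \<open>p\<close> should have the extreme coordinates \<open>1\<close> and \<open>-t\<close> there,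
  \<open>q\<close> the same two exchanged, and both a common coordinate \<open>w\<close> on the other \<open>d - 1\<close> normals; that
  the coordinates sum to zero forces \<open>w = (t - 1)/(d - 1)\<close>, and \<open>t \<le> d\<close> makes \<open>w \<le> 1\<close>.\<close>
lemma edge_difference_in_truncated_simplex:
  fixes k j :: "'n::finite option"
  assumes t: "1 \<le> t" "t \<le> real CARD('n)" and "k \<noteq> j"
  shows "\<exists>p\<in>truncated_simplex t. \<exists>q\<in>truncated_simplex t.
    ((t + 1) * real CARD('n) / (real CARD('n) + 1)) *\<^sub>R (dual_vertex k - dual_vertex j) = p - q"
proof -
  define d where "d = real CARD('n)"
  \<comment> \<open>For \<open>d = 1\<close> we have \<open>t = 1\<close>, and \<open>0 / 0 = 0\<close> satisfies the equation for \<open>w\<close> as well.\<close>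
  define w where "w = (t - 1) / (d - 1)"
  have w: "0 \<le> w" "w \<le> 1" "(d - 1) * w = t - 1"
    using t by (auto simp: w_def d_def divide_le_eq)
  define f where "f k j m = (if m = k then 1 else if m = j then - t else w)" for k j m :: "'n option"
  have sum: "(\<Sum>m\<in>UNIV. f k j m) = 0" if "k \<noteq> j" for k j
  proof -
    have "(\<Sum>m\<in>UNIV. f k j m)
        = (\<Sum>m\<in>UNIV. (if m = k then 1 - w else 0) + (if m = j then - t - w else 0) + w)"
      using that by (intro sum.cong) (auto simp: f_def)
    also have "\<dots> = (1 - w) + (- t - w) + (d + 1) * w"
      by (simp add: sum.distrib d_def card_UNIV_option)
    also have "\<dots> = 0" using w(3) by (simp add: algebra_simps)
    finally show ?thesis .
  qed
  obtain p where p: "\<And>m. facet_normal m \<bullet> p = f k j m"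
    using point_with_facet_coordinates[OF sum[OF \<open>k \<noteq> j\<close>]] by blast
  obtain q where q: "\<And>m. facet_normal m \<bullet> q = f j k m"
    using point_with_facet_coordinates[OF sum] \<open>k \<noteq> j\<close> by metis
  have "p \<in> truncated_simplex t" "q \<in> truncated_simplex t"
    using w t by (auto simp: truncated_simplex_def p q f_def)
  moreover have "((t + 1) * d / (d + 1)) *\<^sub>R (dual_vertex k - dual_vertex j) = p - q"
  proof (rule eq_by_facet_normals)
    fix m :: "'n option"
    have d: "d > 0" by (simp add: d_def)
    have "(t + 1) * d / (d + 1) * (1 + 1 / d) = t + 1"
      "(t + 1) * d / (d + 1) * (- (1 / d) - 1) = - t - 1"
      using d by (simp_all add: divide_simps) (simp_all add: algebra_simps)
    then show "facet_normal m \<bullet> ((t + 1) * d / (d + 1)) *\<^sub>R (dual_vertex k - dual_vertex j)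
        = facet_normal m \<bullet> (p - q)"
      using \<open>k \<noteq> j\<close> by (auto simp: inner_diff_right p q f_def facet_normal_dual_vertex
          simp flip: d_def)
  qed
  ultimately show ?thesis unfolding d_def by blast
qed

text \<open>With \<open>D = ((s + 1)/(t + 1)) (C - C)\<close> the claim follows from \<open>K - K \<subseteq> D\<close>. As \<open>D\<close> is convex, it
  suffices to consider differences of the points \<open>s u\<^sub>k\<close> and \<open>-u\<^sub>k\<close> that span \<open>K\<close>. These are, up to
  sign, multiples \<open>r (u\<^sub>k - u\<^sub>j)\<close> with \<open>r \<le> s\<close>, which are shortenings of the edge differences in \<open>D\<close>
  (here \<open>s \<le> d\<close> is needed), and sums \<open>s u\<^sub>k + u\<^sub>j\<close>, which lie between the radial differences
  \<open>(s + 1) u\<^sub>k\<close> and \<open>(s + 1) u\<^sub>j\<close> in \<open>D\<close>.\<close>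
lemma C_radius1_two_simplex_hull_le:
  assumes s: "1 \<le> s" "s \<le> real CARD('n)" and t: "1 \<le> t" "t \<le> real CARD('n)"
  shows "C_radius1 (two_simplex_hull s :: (real ^ 'n::finite) set) (truncated_simplex t)
    \<le> ennreal ((s + 1) / (t + 1))"
proof -
  let ?K = "two_simplex_hull s :: (real ^ 'n) set"
  let ?C = "truncated_simplex t :: (real ^ 'n) set"
  define d where "d = real CARD('n)"
  define \<rho> where "\<rho> = (s + 1) / (t + 1)"
  define D where "D = (\<lambda>x. \<rho> *\<^sub>R x) ` (\<Union>p\<in>?C. \<Union>q\<in>?C. {p - q})"
  have \<rho>: "\<rho> > 0" "\<rho> * (t + 1) = s + 1" using s t by (auto simp: \<rho>_def)
  have C: "convex ?C" "0 \<in> ?C"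
    using convex_body_truncated_simplex[of t] t
    by (auto simp: convex_body_def truncated_simplex_def)
  have D: "convex D" unfolding D_def by (intro convex_scaling convex_differences C)
  have D_neg: "- x \<in> D" if "x \<in> D" for x
    using that unfolding D_def by (force intro!: image_eqI[where x = "- y" for y])
  have D0: "0 \<in> D" using C(2) unfolding D_def by force
  have rad: "(s + 1) *\<^sub>R dual_vertex k \<in> D" for k
  proof -
    have "\<rho> *\<^sub>R ((t + 1) *\<^sub>R dual_vertex k) \<in> D"
      unfolding D_def using radial_difference_in_truncated_simplex[OF t, of k]
      by (intro imageI) blast
    then show ?thesis by (simp add: \<rho>(2))
  qed
  have edge: "r *\<^sub>R (dual_vertex k - dual_vertex j) \<in> D" if r: "0 \<le> r" "r \<le> s" for r k j
  proof (cases "k = j")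
    case False
    define l where "l = (s + 1) * d / (d + 1)"
    have d: "d \<ge> 1" "s \<le> d" using s by (auto simp: d_def)
    have "\<rho> *\<^sub>R (((t + 1) * d / (d + 1)) *\<^sub>R (dual_vertex k - dual_vertex j)) \<in> D"
      unfolding D_def d_def using edge_difference_in_truncated_simplex[OF t False]
      by (intro imageI) blast
    moreover have "\<rho> * ((t + 1) * d / (d + 1)) = l"
      by (simp add: l_def flip: \<rho>(2))
    ultimately have lD: "l *\<^sub>R (dual_vertex k - dual_vertex j) \<in> D" by (simp only: scaleR_scaleR)
    have l0: "l > 0" using s d by (simp add: l_def)
    have "s * (d + 1) \<le> (s + 1) * d" using d by (simp add: algebra_simps)
    then have "s \<le> l" using d by (simp add: l_def pos_le_divide_eq)
    then have rl: "r / l \<le> 1" "0 \<le> r / l" using r l0 by auto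
    have "(r / l) *\<^sub>R (l *\<^sub>R (dual_vertex k - dual_vertex j)) + (1 - r / l) *\<^sub>R 0 \<in> D"
      using rl by (intro convexD[OF D lD D0]) auto
    moreover have "r / l * l = r" using l0 by simp
    ultimately show ?thesis by (simp only: scaleR_scaleR scaleR_zero_right add_0_right)
  qed (simp add: D0)
  have mix: "s *\<^sub>R dual_vertex k + dual_vertex j \<in> D" for k j
  proof -
    have "(s / (s + 1)) *\<^sub>R ((s + 1) *\<^sub>R dual_vertex k)
        + (1 / (s + 1)) *\<^sub>R ((s + 1) *\<^sub>R dual_vertex j) \<in> D"
      using s by (intro convexD[OF D rad rad]) (auto simp flip: add_divide_distrib)
    then show ?thesis using s by simp
  qed
  have gen: "x - s *\<^sub>R dual_vertex j \<in> D" "x - - dual_vertex j \<in> D" if "x \<in> ?K" for x j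
  proof -
    have cv: "convex {x. x - b \<in> D}" for b
    proof -
      have "{x. x - b \<in> D} = (\<lambda>y. b + y) ` D" by (force simp: image_iff)
      then show ?thesis using convex_translation[OF D, of b] by simp
    qed
    have "?K \<subseteq> {x. x - s *\<^sub>R dual_vertex j \<in> D}"
    proof (intro two_simplex_hull_subset cv; clarify)
      fix k
      show "s *\<^sub>R dual_vertex k - s *\<^sub>R dual_vertex j \<in> D"
        using edge[of s k j] s by (simp add: scaleR_diff_right)
      show "- dual_vertex k - s *\<^sub>R dual_vertex j \<in> D"
        using D_neg[OF mix[of j k]] by (simp add: algebra_simps)
    qed
    then show "x - s *\<^sub>R dual_vertex j \<in> D" using that by blast
    have "?K \<subseteq> {x. x - - dual_vertex j \<in> D}"
    proof (intro two_simplex_hull_subset cv; clarify)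
      fix k
      show "s *\<^sub>R dual_vertex k - - dual_vertex j \<in> D" using mix[of k j] by simp
      show "- dual_vertex k - - dual_vertex j \<in> D"
        using edge[of 1 j k] s by simp
    qed
    then show "x - - dual_vertex j \<in> D" using that by blast
  qed
  have diff: "x - y \<in> D" if "x \<in> ?K" "y \<in> ?K" for x y
  proof -
    have "{y. x - y \<in> D} = (\<lambda>z. x - z) ` D" by (force simp: image_iff)
    also have "\<dots> = (\<lambda>z. x + z) ` uminus ` D" by (simp add: image_image)
    finally have "convex {y. x - y \<in> D}"
      using convex_translation[OF convex_negations[OF D], of x] by simp
    then have "?K \<subseteq> {y. x - y \<in> D}"
      using gen[OF that(1)] by (intro two_simplex_hull_subset) auto
    then show ?thesis using that by blast
  qed
  show ?thesis unfolding C_radius1_def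
  proof (rule Sup_least)
    fix r assume "r \<in> {C_radius (closed_segment x y) ?C |x y. x \<in> ?K \<and> y \<in> ?K}"
    then obtain x y where xy: "x \<in> ?K" "y \<in> ?K" "r = C_radius (closed_segment x y) ?C" by blast
    obtain p q where "p \<in> ?C" "q \<in> ?C" "x - y = \<rho> *\<^sub>R (p - q)"
      using diff[OF xy(1,2)] unfolding D_def by blast
    then show "r \<le> ennreal ((s + 1) / (t + 1))"
      using C_radius_segment_le[OF C(1), of p q \<rho> x y] \<rho>(1) xy(3) by (simp add: \<rho>_def)
  qed
qed

lemma C_radius_two_simplex_hull_ge:
  "ennreal s \<le> C_radius (two_simplex_hull s :: (real ^ 'n::finite) set) (truncated_simplex t)"
proof (rule C_radius_ge_by_normals[where I = UNIV and a = facet_normal])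
  fix k :: "'n option"
  show "\<exists>y\<in>two_simplex_hull s. s \<le> facet_normal k \<bullet> y"
    using vertices_in_two_simplex_hull(1)[of s k]
    by (rule rev_bexI) (simp add: facet_normal_dual_vertex)
qed (auto simp: sum_facet_normal truncated_simplex_def)

lemma asymmetry1_eq:
  fixes K :: "'a::euclidean_space set"
  assumes "minkowski_asymmetry K \<noteq> 0"
  shows "minkowski_asymmetry1 K = minkowski_asymmetry K"
proof -
  have "minkowski_asymmetry {x} = 0" for x :: 'a
    using C_radius_le[of 0 "uminus ` {x}" "- x" "{x}"] by (simp add: minkowski_asymmetry_def)
  then show ?thesis
    using assms by (auto simp: minkowski_asymmetry1_def is_singleton_def)
qed

text \<open>Neither convention of \<^const>\<open>ratio\<close> for indeterminate forms can apply here, as the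
  numerator is positive and the denominator finite.\<close>
lemma ratio_ge:
  assumes "ennreal a \<le> x" "y \<le> ennreal b" "a > 0" "b > 0"
  shows "ennreal (a / b) \<le> ratio x y"
proof -
  have "y \<noteq> \<infinity>" "x \<noteq> 0" using assms by (auto simp: top_unique)
  then have "ratio x y = x / y" by (simp add: ratio_def)
  moreover have "ennreal (a / b) \<le> x / y"
  proof (cases "y = 0")
    case True
    then show ?thesis using \<open>x \<noteq> 0\<close> by (simp add: ennreal_divide_zero)
  next
    case False
    then obtain z where z: "y = ennreal z" "0 < z"
      using \<open>y \<noteq> \<infinity>\<close> by (cases y) (auto simp: less_le)
    then have "z \<le> b" using assms by simp
    then have "ennreal (a / b) \<le> ennreal (a / z)"
      using assms z by (intro ennreal_leI divide_left_mono) auto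
    also have "\<dots> = ennreal a / y" using z assms by (simp add: divide_ennreal)
    also have "\<dots> \<le> x / y" using assms by (intro divide_right_mono_ennreal)
    finally show ?thesis .
  qed
  ultimately show ?thesis by simp
qed

lemma radius_ratio_tight:
  assumes s: "1 \<le> s" "s \<le> real CARD('n)" and t: "1 \<le> t" "t \<le> real CARD('n)"
  defines "K \<equiv> two_simplex_hull s :: (real ^ 'n::finite) set"
  defines "C \<equiv> truncated_simplex t :: (real ^ 'n) set"
  shows "ratio (C_radius K C) (C_radius1 K C)
    = (minkowski_asymmetry C + 1) * minkowski_asymmetry K / (minkowski_asymmetry K + 1)"
proof (rule antisym)
  have K: "convex_body K" "minkowski_asymmetry K = ennreal s"
    unfolding K_def by (rule convex_body_two_simplex_hull, rule asymmetry_two_simplex_hull[OF s])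
  have C: "convex_body C" "minkowski_asymmetry C = ennreal t"
    unfolding C_def using convex_body_truncated_simplex[of t] asymmetry_truncated_simplex[OF t] t
    by auto
  have "minkowski_asymmetry K \<noteq> 0" "minkowski_asymmetry C \<noteq> 0" using s t by (simp_all add: K C)
  then have [simp]: "minkowski_asymmetry1 K = minkowski_asymmetry K"
    "minkowski_asymmetry1 C = minkowski_asymmetry C"
    by (simp_all only: asymmetry1_eq simp_thms)
  show "ratio (C_radius K C) (C_radius1 K C)
      \<le> (minkowski_asymmetry C + 1) * minkowski_asymmetry K / (minkowski_asymmetry K + 1)"
    using radius_ratio_le[OF K(1) C(1)] by simp
  have "ennreal (s / ((s + 1) / (t + 1))) \<le> ratio (C_radius K C) (C_radius1 K C)"
    using s t C_radius1_two_simplex_hull_le[OF s t] unfolding K_def C_def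
    by (intro ratio_ge C_radius_two_simplex_hull_ge) auto
  then show "(minkowski_asymmetry C + 1) * minkowski_asymmetry K / (minkowski_asymmetry K + 1)
      \<le> ratio (C_radius K C) (C_radius1 K C)"
    using s t asymmetry_bound_ennreal[of s t] by (simp add: K C mult.commute)
qed

theorem theorem4p1:
  "(\<forall>K C :: (real ^ 'n) set. convex_body K \<and> convex_body C \<longrightarrow>
      ratio (C_radius K C) (C_radius1 K C)
        \<le> (minkowski_asymmetry1 C + 1) * minkowski_asymmetry1 K / (minkowski_asymmetry1 K + 1))
   \<and>
   (\<forall>\<sigma>K \<sigma>C :: real. \<sigma>K \<in> {1..real CARD('n)} \<and> \<sigma>C \<in> {1..real CARD('n)} \<longrightarrow>
      (\<exists>K C :: (real ^ 'n) set. convex_body K \<and> convex_body C \<and>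
         minkowski_asymmetry K = ennreal \<sigma>K \<and> minkowski_asymmetry C = ennreal \<sigma>C \<and>
         ratio (C_radius K C) (C_radius1 K C)
           = (minkowski_asymmetry C + 1) * minkowski_asymmetry K / (minkowski_asymmetry K + 1)))"
proof (intro conjI allI impI)
  fix K C :: "(real ^ 'n) set"
  assume "convex_body K \<and> convex_body C"
  then show "ratio (C_radius K C) (C_radius1 K C)
      \<le> (minkowski_asymmetry1 C + 1) * minkowski_asymmetry1 K / (minkowski_asymmetry1 K + 1)"
    by (intro radius_ratio_le) auto
next
  fix s t :: real
  assume "s \<in> {1..real CARD('n)} \<and> t \<in> {1..real CARD('n)}"
  then have s: "1 \<le> s" "s \<le> real CARD('n)" and t: "1 \<le> t" "t \<le> real CARD('n)" by auto
  show "\<exists>K C :: (real ^ 'n) set. convex_body K \<and> convex_body C \<and>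
      minkowski_asymmetry K = ennreal s \<and> minkowski_asymmetry C = ennreal t \<and>
      ratio (C_radius K C) (C_radius1 K C)
        = (minkowski_asymmetry C + 1) * minkowski_asymmetry K / (minkowski_asymmetry K + 1)"
    using t by (intro exI[of _ "two_simplex_hull s"] exI[of _ "truncated_simplex t"] conjI
        convex_body_two_simplex_hull convex_body_truncated_simplex asymmetry_two_simplex_hull[OF s]
        asymmetry_truncated_simplex[OF t] radius_ratio_tight[OF s t]) auto
qed

end
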